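(* Let $t,s$ be positive integers with $s\le t$, $\alpha$ a primitive element of $\mathbb{F}_{q^t}$ with minimal polynomial $m_\alpha$ over $\mathbb{F}_q$, and $I=\{i_0,\dots,i_{s-1}\}$ a subset of $[0,q^t-2]$ of size $s$. Then the following statements are equivalent. 1. The $q^t\times s$ array $\mathcal{A}_{\mathbf 0}(\alpha,I)$ is an $\mathrm{OA}_{q^{t-s}}(s,s,q)$. 2. The set $\{\alpha^{i_j}\mid j\in[0,s-1]\}$ is linearly independent over $\mathbb{F}_q$. 3. The set $\{L^{i_j}_{q^t-1}(\mathrm{Seq}(\alpha))\mid j\in[0,s-1]\}$ is linearly independent over $\mathbb{F}_q$. 4. For every $d_0,\dots,d_{s-1}\in\mathbb{F}_q$ not all zero, $m_\alpha(x)$ does not divide $\sum_{j=0}^{s-1}d_jx^{i_j}$. 5. There is no $(s-2)$-flat of $PG(t-1,q)$ that contains the points $[\alpha^{i_0}],\dots,[\alpha^{i_{s-1}}]$. In the special case $s=t$, the following is also equivalent to the statements above. 6. There is no zero row in $\mathcal{A}(\alpha,I)$.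
   Context: $q$ is a prime power. For integers $a\le b$, $[a,b]=\{a,\dots,b\}$. A primitive element of a finite field is a generator of its multiplicative group. $\mathrm{Tr}(x)=x+x^q+\dots+x^{q^{t-1}}$ is the trace from $\mathbb{F}_{q^t}$ to $\mathbb{F}_q$. $\mathcal{A}(\alpha,I)$ is the $(q^t-1)\times s$ array over $\mathbb{F}_q$ whose row $i$, for $i\in[0,q^t-2]$, is $(\mathrm{Tr}(\alpha^{i+i_0}),\dots,\mathrm{Tr}(\alpha^{i+i_{s-1}}))$, and $\mathcal{A}_{\mathbf 0}(\alpha,I)$ is the $q^t\times s$ array obtained from it by appending a row of zeros. $\mathrm{Seq}(\alpha)=(\mathrm{Tr}(\alpha^i))_{i\ge0}$ and $L^c_n(\mathrm{Seq}(\alpha))=(\mathrm{Tr}(\alpha^{i+c}))_{i=0}^{n-1}\in\mathbb{F}_q^n$. An orthogonal array $\mathrm{OA}_\lambda(s,k,v)$ ($s\le k$) is a $\lambda v^s\times k$ array over an alphabet $V$ of size $v$ such that for every $s$ distinct columns, each element of $V^s$ occurs exactly $\lambda$ times as a row of the subarray formed by these columns. $PG(t-1,q)$ is the projective space whose points are the one-dimensional $\mathbb{F}_q$-subspaces of $\mathbb{F}_{q^t}$; $[x]$ is the point spanned by $x\neq0$. A $k$-flat is the set of points $\{[x]\mid x\in S\setminus\{0\}\}$ for an $\mathbb{F}_q$-subspace $S$ of dimension $k+1$ (so a $(-1)$-flat is empty). *)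

theory Defs
  imports "Jordan_Normal_Form.VS_Connect" "Jordan_Normal_Form.Char_Poly" "HOL-Number_Theory.Prime_Powers"
    "HOL-Library.Cardinality"
begin

text \<open>
  The extension of \<open>\<bbbF>\<^sub>q\<close> by \<open>\<bbbF>\<^bsub>q^t\<^esub>\<close> is given by two types \<open>'q\<close>, \<open>'k\<close> of class
  \<^class>\<open>finite_field\<close> and an embedding \<open>emb :: 'q \<Rightarrow> 'k\<close> with \<open>field_hom emb\<close>.
\<close>

definition ext_scale :: "('q::finite_field \<Rightarrow> 'k::finite_field) \<Rightarrow> 'q \<Rightarrow> 'k \<Rightarrow> 'k" where
  "ext_scale emb c x = emb c * x"

lemma vector_space_ext_scale:
  assumes "field_hom emb"
  shows "vector_space (ext_scale emb)"
proof -
  interpret field_hom emb by fact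
  show ?thesis
    by unfold_locales (simp_all add: ext_scale_def hom_distribs algebra_simps)
qed

definition primitive_element :: "'k::finite_field \<Rightarrow> bool" where
  "primitive_element a \<longleftrightarrow> a \<noteq> 0 \<and> range (\<lambda>n::int. a powi n) = UNIV - {0}"

text \<open>The trace is an element of the small field: \<open>emb_field_trace\<close> below shows that the
  power sum does lie in the image of \<open>emb\<close>.\<close>

definition field_trace :: "('q::finite_field \<Rightarrow> 'k::finite_field) \<Rightarrow> nat \<Rightarrow> 'k \<Rightarrow> 'q" where
  "field_trace emb t x = the_inv emb (\<Sum>k<t. x ^ (CARD('q) ^ k))"

definition minimal_poly :: "('q::finite_field \<Rightarrow> 'k::finite_field) \<Rightarrow> 'k \<Rightarrow> 'q poly" where
  "minimal_poly emb a = (THE p. lead_coeff p = 1 \<and> poly (map_poly emb p) a = 0 \<and>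
     (\<forall>r. r \<noteq> 0 \<and> poly (map_poly emb r) a = 0 \<longrightarrow> degree p \<le> degree r))"

definition trace_seq :: "('q::finite_field \<Rightarrow> 'k::finite_field) \<Rightarrow> nat \<Rightarrow> 'k \<Rightarrow> nat \<Rightarrow> 'q" where
  "trace_seq emb t a = (\<lambda>n. field_trace emb t (a ^ n))"

definition seq_window :: "nat \<Rightarrow> nat \<Rightarrow> (nat \<Rightarrow> 'a) \<Rightarrow> 'a vec" where
  "seq_window n c f = vec n (\<lambda>k. f (k + c))"

text \<open>The columns are listed in the order \<open>i 0, \<dots>, i (s - 1)\<close> of the given enumeration of \<open>I\<close>.\<close>

definition trace_array ::
    "('q::finite_field \<Rightarrow> 'k::finite_field) \<Rightarrow> nat \<Rightarrow> 'k \<Rightarrow> nat \<Rightarrow> (nat \<Rightarrow> nat) \<Rightarrow> 'q mat" where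
  "trace_array emb t a s i =
     mat (CARD('q) ^ t - 1) s (\<lambda>(r, j). field_trace emb t (a ^ (r + i j)))"

definition trace_array0 ::
    "('q::finite_field \<Rightarrow> 'k::finite_field) \<Rightarrow> nat \<Rightarrow> 'k \<Rightarrow> nat \<Rightarrow> (nat \<Rightarrow> nat) \<Rightarrow> 'q mat" where
  "trace_array0 emb t a s i = trace_array emb t a s i @\<^sub>r 0\<^sub>m 1 s"

text \<open>\<open>orthogonal_array V l s k v A\<close>: \<open>A\<close> is an \<open>OA\<^sub>l(s, k, v)\<close> over the alphabet \<open>V\<close>.
  A set \<open>C\<close> of \<open>s\<close> columns stands for the subarray, and an element of \<open>V\<^sup>s\<close> is a function
  from \<open>C\<close> to \<open>V\<close>.\<close>

definition orthogonal_array :: "'v set \<Rightarrow> nat \<Rightarrow> nat \<Rightarrow> nat \<Rightarrow> nat \<Rightarrow> 'v mat \<Rightarrow> bool" where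
  "orthogonal_array V l s k v A \<longleftrightarrow>
     s \<le> k \<and> finite V \<and> card V = v \<and>
     dim_row A = l * v ^ s \<and> dim_col A = k \<and> elements_mat A \<subseteq> V \<and>
     (\<forall>C w. C \<subseteq> {..<k} \<and> card C = s \<and> w \<in> C \<rightarrow> V \<longrightarrow>
        card {r. r < dim_row A \<and> (\<forall>c\<in>C. A $$ (r, c) = w c)} = l)"

definition proj_point :: "('q::finite_field \<Rightarrow> 'k::finite_field) \<Rightarrow> 'k \<Rightarrow> 'k set" where
  "proj_point emb x = Modules.module.span (ext_scale emb) {x}"

text \<open>The projective dimension \<open>k\<close> is an integer because \<open>k = -1\<close> (the empty flat) is allowed.\<close>

definition is_flat :: "('q::finite_field \<Rightarrow> 'k::finite_field) \<Rightarrow> int \<Rightarrow> 'k set set \<Rightarrow> bool" where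
  "is_flat emb k P \<longleftrightarrow>
     (\<exists>S. Modules.module.subspace (ext_scale emb) S \<and>
          int (vector_space.dim (ext_scale emb) S) = k + 1 \<and>
          P = proj_point emb ` (S - {0}))"

lemma CHAR_dvd_CARD: "CHAR('q::finite_field) dvd CARD('q)"
proof -
  have "(\<Sum>x\<in>UNIV. x) = (\<Sum>x\<in>UNIV. x + 1 :: 'q)"
    by (rule sum.reindex_bij_witness[of _ "\<lambda>x. x + 1" "\<lambda>x. x - 1"]) auto
  then have "of_nat CARD('q) = (0 :: 'q)"
    by (simp add: sum.distrib)
  then show ?thesis
    by (simp add: of_nat_eq_0_iff_char_dvd)
qed

lemma primepow_CARD_eq_CHAR_power:
  assumes "primepow CARD('q::finite_field)"
  obtains n where "CARD('q) = CHAR('q) ^ n"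
proof -
  obtain p n where pn: "prime p" "n > 0" "CARD('q) = p ^ n"
    using assms by (auto simp: primepow_def)
  have "CHAR('q) dvd p ^ n"
    using CHAR_dvd_CARD[where 'q = 'q] pn(3) by simp
  then have "CHAR('q) dvd p"
    using CHAR_prime[where 'a = 'q] prime_dvd_power by blast
  then have "CHAR('q) = p"
    using CHAR_prime[where 'a = 'q] pn(1) primes_dvd_imp_eq by blast
  then show ?thesis using that pn by blast
qed

lemma range_emb_iff:
  fixes emb :: "'q::finite_field \<Rightarrow> 'k::finite_field"
  assumes "field_hom emb"
  shows "x \<in> range emb \<longleftrightarrow> x ^ CARD('q) = x"
proof -
  interpret field_hom emb by fact
  let ?f = "monom 1 (CARD('q)) - monom 1 1 :: 'k poly"
  have q: "CARD('q) > 1"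
    using card_mono[of "UNIV :: 'q set" "{0, 1}"] by simp
  have "coeff ?f (CARD('q)) = 1" using q by simp
  then have f0: "?f \<noteq> 0" by (metis coeff_0 zero_neq_one)
  have "degree ?f \<le> CARD('q)"
    using q by (intro degree_diff_le) (auto simp: degree_monom_eq)
  then have "card {x. poly ?f x = 0} \<le> CARD('q)"
    using card_poly_roots_bound[OF f0] by linarith
  moreover have "{x. poly ?f x = 0} = {x. x ^ CARD('q) = x}"
    by (simp add: poly_monom)
  moreover have "emb y ^ CARD('q) = emb y" for y
    by (metis hom_power finite_field_power_card_eq_same)
  then have "range emb \<subseteq> {x. x ^ CARD('q) = x}" by auto
  moreover have "card (range emb) = CARD('q)"
    by (rule card_image) (auto intro: injI)
  ultimately have "range emb = {x. x ^ CARD('q) = x}"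
    by (intro card_seteq) auto
  then show ?thesis by blast
qed

lemma emb_field_trace:
  fixes emb :: "'q::finite_field \<Rightarrow> 'k::finite_field"
  assumes emb: "field_hom emb" and q: "primepow CARD('q)" and card: "CARD('k) = CARD('q) ^ t"
  shows "emb (field_trace emb t x) = (\<Sum>k<t. x ^ (CARD('q) ^ k))"
proof -
  interpret field_hom emb by fact
  obtain n where n: "CARD('q) = CHAR('q) ^ n"
    using q by (rule primepow_CARD_eq_CHAR_power)
  have "of_nat CHAR('q) = (0 :: 'k)"
    by (metis hom_of_nat of_nat_CHAR hom_zero)
  then have "CHAR('k) dvd CHAR('q)" by (simp add: of_nat_eq_0_iff_char_dvd)
  then have c: "CHAR('k) = CHAR('q)"
    using CHAR_prime primes_dvd_imp_eq by blast
  let ?y = "\<Sum>k<t. x ^ (CARD('q) ^ k)"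
  have "?y ^ CARD('q) = (\<Sum>k<t. (x ^ (CARD('q) ^ k)) ^ CARD('q))"
    by (rule freshmans_dream_sum') (use n c CHAR_prime in auto)
  also have "\<dots> = (\<Sum>k<t. x ^ (CARD('q) ^ Suc k))"
    by (simp add: power_mult [symmetric] mult.commute)
  also have "\<dots> = ?y"
  proof -
    have "(\<Sum>k<Suc t. x ^ (CARD('q) ^ k)) = x + (\<Sum>k<t. x ^ (CARD('q) ^ Suc k))"
      by (subst sum.lessThan_Suc_shift) simp
    moreover have "(\<Sum>k<Suc t. x ^ (CARD('q) ^ k)) = ?y + x"
      by (simp add: card [symmetric] finite_field_power_card_eq_same)
    ultimately show ?thesis by (simp add: add.commute)
  qed
  finally have "?y \<in> range emb" using range_emb_iff[OF emb] by blast
  moreover have "inj emb" by (auto intro: injI)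
  ultimately show ?thesis unfolding field_trace_def by (rule f_the_inv_into_f[rotated])
qed

lemma minimal_poly_unique:
  fixes emb :: "'q::finite_field \<Rightarrow> 'k::finite_field"
  assumes emb: "field_hom emb"
  shows "\<exists>!p. lead_coeff p = 1 \<and> poly (map_poly emb p) a = 0 \<and>
     (\<forall>r. r \<noteq> 0 \<and> poly (map_poly emb r) a = 0 \<longrightarrow> degree p \<le> degree r)"
proof -
  interpret field_hom emb by fact
  interpret hp: map_poly_comm_ring_hom emb ..
  let ?R = "\<lambda>r. r \<noteq> 0 \<and> poly (map_poly emb r) a = 0"
  have k: "CARD('k) > 1"
    using card_mono[of "UNIV :: 'k set" "{0, 1}"] by simp
  let ?f = "monom 1 (CARD('k)) - monom 1 1 :: 'q poly"
  have "coeff ?f (CARD('k)) = 1" using k by simp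
  then have "?f \<noteq> 0" by (metis coeff_0 zero_neq_one)
  moreover have "poly (map_poly emb ?f) a = 0"
    by (simp add: hp.hom_minus map_poly_monom poly_monom finite_field_power_card_eq_same)
  ultimately obtain p0 where p0: "?R p0" "\<And>r. ?R r \<Longrightarrow> degree p0 \<le> degree r"
    using ex_has_least_nat[of ?R ?f degree] by blast
  define p where "p = Polynomial.smult (inverse (lead_coeff p0)) p0"
  have map: "map_poly emb (Polynomial.smult c r) = Polynomial.smult (emb c) (map_poly emb r)" for c r
    by (rule poly_eqI) (simp add: coeff_map_poly hom_distribs)
  have p: "lead_coeff p = 1" "poly (map_poly emb p) a = 0" "degree p = degree p0"
    using p0 by (auto simp: p_def map)
  show ?thesis
  proof (rule ex1I[of _ p])
    show "lead_coeff p = 1 \<and> poly (map_poly emb p) a = 0 \<and>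
        (\<forall>r. ?R r \<longrightarrow> degree p \<le> degree r)"
      using p p0 by simp
  next
    fix p' assume p': "lead_coeff p' = 1 \<and> poly (map_poly emb p') a = 0 \<and>
        (\<forall>r. ?R r \<longrightarrow> degree p' \<le> degree r)"
    have nz: "p \<noteq> 0" "p' \<noteq> 0" using p p' by auto
    have deg: "degree p' = degree p" using p p' p0 nz by (metis le_antisym)
    show "p' = p"
    proof (rule ccontr)
      assume ne: "p' \<noteq> p"
      have "?R (p' - p)" using ne p p' by (simp add: hp.hom_minus)
      then have "degree p \<le> degree (p' - p)" using p0 p by simp
      moreover have "degree (p' - p) \<le> degree p" using deg by (intro degree_diff_le) auto
      ultimately have "degree (p' - p) = degree p" by simp
      then have "lead_coeff (p' - p) = 0" using p p' deg by simp
      then have "p' - p = 0" by (rule leading_coeff_0_iff [THEN iffD1])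
      then show False using ne by simp
    qed
  qed
qed

end

(*
  The trace form (x, y) |-> Tr (x * y) on F_{q^t} is nondegenerate, so for a basis B the coordinate
  map y |-> (Tr (y * b)) for b in B is injective and, by counting, a bijection onto F_q^B.
  An independent set S extends to such a basis, hence each system Tr (y * b) = w b (b in S) has
  exactly q^(t - card S) solutions y; conversely, if all these systems are solvable, then S is
  independent.  As the rows of A_0 are indexed by all y in F_{q^t} (the powers of alpha and 0),
  this gives 1 <-> 2 and 6 <-> 2.  For 3, x |-> (Tr (alpha^k * x))_k is an injective linear map
  which sends alpha^(i_j) to the window starting at i_j.
*)
theory Submission
  imports Defs
begin

section \<open>Powers of a primitive element\<close>

text \<open>\<open>primitive_element\<close> speaks of integer exponents. Since \<alpha> to the
  power \<open>CARD('k) - 1\<close> is 1, they may be reduced to this range, and a surjection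
  between finite sets of equal size is injective.\<close>

lemma bij_betw_primitive_powers:
  fixes \<alpha> :: "'k::finite_field"
  assumes "primitive_element \<alpha>"
  shows "bij_betw (\<lambda>k. \<alpha> ^ k) {..<CARD('k) - 1} (UNIV - {0})"
proof -
  let ?N = "CARD('k) - 1"
  have nz: "\<alpha> \<noteq> 0" using assms by (simp add: primitive_element_def)
  have N: "?N > 0" using card_mono[of "UNIV :: 'k set" "{0, 1}"] by simp
  have "\<alpha> * \<alpha> ^ ?N = \<alpha> ^ CARD('k)" using N by (metis Suc_diff_1 power_Suc zero_less_card_finite)
  then have one: "\<alpha> ^ ?N = 1" using nz by (simp add: finite_field_power_card_eq_same)
  have "(\<lambda>k. \<alpha> ^ k) ` {..<?N} = UNIV - {0}"
  proof (intro equalityI subsetI)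
    fix x :: 'k assume "x \<in> UNIV - {0}"
    then obtain n :: int where n: "x = \<alpha> powi n"
      using assms unfolding primitive_element_def by (metis imageE)
    let ?r = "nat (n mod int ?N)"
    have add: "\<alpha> powi (a + b) = \<alpha> powi a * \<alpha> powi b" for a b
      using nz by (simp add: power_int_add)
    \<comment> \<open>Division of the exponent by \<open>?N\<close> with remainder; the multiple of
      \<open>?N\<close> contributes the factor 1.\<close>
    have "\<alpha> powi n = \<alpha> powi (int ?N * (n div int ?N) + n mod int ?N)" by simp
    also have "\<dots> = (\<alpha> powi int ?N) powi (n div int ?N) * \<alpha> powi (n mod int ?N)"
      by (simp only: add power_int_mult)
    also have "\<dots> = \<alpha> powi (n mod int ?N)"
      by (simp only: power_int_of_nat one power_int_1_left mult_1)
    also have "\<dots> = \<alpha> powi (int ?r)" using N by simp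
    finally have "x = \<alpha> ^ ?r" using n by (simp only: power_int_of_nat)
    moreover have "n mod int ?N < int ?N" using N by (intro pos_mod_bound) simp
    then have "?r < ?N" using N by (simp add: nat_less_iff)
    ultimately show "x \<in> (\<lambda>k. \<alpha> ^ k) ` {..<?N}" by blast
  qed (use nz in auto)
  moreover have "card (UNIV - {0 :: 'k}) = card {..<?N}" by (simp add: card_Diff_subset)
  ultimately show ?thesis
    unfolding bij_betw_def by (simp add: eq_card_imp_inj_on)
qed

section \<open>The field extension and its trace form\<close>

text \<open>The degree \<open>t\<close> enters through cardinalities; that it is the dimension over
  the small field is derived in \<open>card_spanning_independent\<close>.\<close>

locale finite_field_extension = field_hom emb
  for emb :: "'q::finite_field \<Rightarrow> 'k::finite_field" +
  fixes t :: nat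
  assumes primepow_card: "primepow CARD('q)"
    and card_ext: "CARD('k) = CARD('q) ^ t"
    and degree_pos: "1 \<le> t"
begin

sublocale V: vector_space "ext_scale emb"
  by (rule vector_space_ext_scale) (rule field_hom_axioms)

abbreviation Tr :: "'k \<Rightarrow> 'q" where "Tr \<equiv> field_trace emb t"

lemma card_base_gt_1: "CARD('q) > 1"
  using card_mono[of "UNIV :: 'q set" "{0, 1}"] by simp

lemma CHAR_ext: "CHAR('k) = CHAR('q)"
proof -
  have "of_nat CHAR('q) = (0 :: 'k)"
    by (metis hom_of_nat of_nat_CHAR hom_zero)
  then have "CHAR('k) dvd CHAR('q)" by (simp add: of_nat_eq_0_iff_char_dvd)
  then show ?thesis using CHAR_prime primes_dvd_imp_eq by blast
qed

text \<open>\<open>Tr\<close> is defined by inverting \<open>emb\<close>, so its properties are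
  computed with this power sum in the large field and then pulled back by injectivity of
  \<open>emb\<close>.\<close>

lemma emb_Tr: "emb (Tr x) = (\<Sum>k<t. x ^ (CARD('q) ^ k))"
  by (rule emb_field_trace) (use field_hom_axioms primepow_card card_ext in auto)

lemma Tr_add: "Tr (x + y) = Tr x + Tr y"
proof -
  obtain n where n: "CARD('q) = CHAR('q) ^ n"
    using primepow_card by (rule primepow_CARD_eq_CHAR_power)
  \<comment> \<open>The exponent is a power of the characteristic, so raising to it is
    additive.\<close>
  have "(x + y) ^ (CARD('q) ^ k) = x ^ (CARD('q) ^ k) + y ^ (CARD('q) ^ k)" for k
    by (rule freshmans_dream'[where n = "n * k"])
      (use n CHAR_prime in \<open>auto simp: CHAR_ext power_mult\<close>)
  then have "emb (Tr (x + y)) = emb (Tr x + Tr y)"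
    by (simp add: emb_Tr hom_add sum.distrib)
  then show ?thesis by simp
qed

lemma Tr_scale: "Tr (emb c * x) = c * Tr x"
proof -
  have "emb c ^ (CARD('q) ^ k) = emb c" for k
    by (metis hom_power finite_field_power_card_power_eq_same)
  then have "emb (Tr (emb c * x)) = emb (c * Tr x)"
    by (simp add: emb_Tr hom_mult power_mult_distrib sum_distrib_left)
  then show ?thesis by simp
qed

lemma Tr_0 [simp]: "Tr 0 = 0"
  using Tr_scale[of 0 0] by simp

lemma Tr_diff: "Tr (x - y) = Tr x - Tr y"
  using Tr_add[of "x - y" y] by simp

lemma Tr_sum: "Tr (sum f A) = (\<Sum>a\<in>A. Tr (f a))"
  by (induction A rule: infinite_finite_induct) (auto simp: Tr_add)

text \<open>The trace is a nonzero polynomial function of degree at most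
  \<open>CARD('q) ^ (t - 1)\<close>, so it has fewer than \<open>CARD('k)\<close> roots.\<close>

lemma Tr_nonzero: "\<exists>z. Tr z \<noteq> 0"
proof (rule ccontr)
  assume *: "\<nexists>z. Tr z \<noteq> 0"
  define P where "P = (\<Sum>k<t. monom 1 (CARD('q) ^ k) :: 'k poly)"
  have "poly P z = 0" for z
    using * emb_Tr[of z] by (simp add: P_def poly_sum poly_monom)
  then have roots: "{z. poly P z = 0} = UNIV" by auto
  \<comment> \<open>The exponents are pairwise distinct because the base exceeds 1, so only the
    summand \<open>k = t - 1\<close> contributes to this coefficient.\<close>
  have "coeff P (CARD('q) ^ (t - 1)) = (\<Sum>k<t. if k = t - 1 then 1 else 0)"
    using card_base_gt_1 by (auto simp: P_def coeff_sum intro!: sum.cong)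
  also have "\<dots> = 1" using degree_pos by simp
  finally have "P \<noteq> 0" by auto
  moreover have "degree P \<le> CARD('q) ^ (t - 1)"
    unfolding P_def
  proof (rule degree_sum_le)
    fix k assume "k \<in> {..<t}"
    then have "k \<le> t - 1" by auto
    then have "CARD('q) ^ k \<le> CARD('q) ^ (t - 1)"
      using card_base_gt_1 by (intro power_increasing) auto
    then show "degree (monom (1::'k) (CARD('q) ^ k)) \<le> CARD('q) ^ (t - 1)"
      by (simp add: degree_monom_eq)
  qed auto
  ultimately have "CARD('k) \<le> CARD('q) ^ (t - 1)"
    using card_poly_roots_bound[of P] roots by simp
  moreover have "CARD('q) ^ (t - 1) < CARD('q) ^ t"
    using card_base_gt_1 degree_pos by (intro power_strict_increasing) auto
  ultimately show False using card_ext by simp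
qed

lemma Tr_nondegenerate:
  assumes "\<And>y. Tr (y * x) = 0"
  shows "x = 0"
proof (rule ccontr)
  assume "x \<noteq> 0"
  obtain z where "Tr z \<noteq> 0" using Tr_nonzero by blast
  with assms[of "z / x"] \<open>x \<noteq> 0\<close> show False by simp
qed

section \<open>Bases and the solution counts of trace systems\<close>

text \<open>Linear combinations identify the coefficient functions on \<open>B\<close> with the
  field elements; comparing cardinalities gives
  \<open>CARD('q) ^ card B = CARD('q) ^ t\<close>.\<close>

lemma card_spanning_independent:
  assumes "V.independent B" "V.span B = UNIV"
  shows "card B = t"
proof -
  let ?F = "B \<rightarrow>\<^sub>E (UNIV :: 'q set)"
  let ?f = "\<lambda>u. \<Sum>b\<in>B. ext_scale emb (u b) b"
  have "inj_on ?f ?F"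
  proof (rule inj_onI)
    fix u v assume uv: "u \<in> ?F" "v \<in> ?F" "?f u = ?f v"
    then have "(\<Sum>b\<in>B. ext_scale emb (u b - v b) b) = 0"
      by (simp add: V.scale_left_diff_distrib sum_subtractf)
    then have "u b - v b = 0" if "b \<in> B" for b
      by (rule V.independentD[OF assms(1) finite subset_refl _ that])
    then have "u b = v b" if "b \<in> B" for b using that by simp
    with uv(1,2) show "u = v" by (rule PiE_ext)
  qed
  moreover have "?f ` ?F = UNIV"
  proof -
    have "x \<in> ?f ` ?F" for x
    proof -
      have "x \<in> V.span B" using assms by simp
      then obtain u where "x = ?f u" by (auto simp: V.span_finite)
      then have "x = ?f (restrict u B)" by simp
      moreover have "restrict u B \<in> ?F" by simp
      ultimately show ?thesis by (rule image_eqI)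
    qed
    then show ?thesis by auto
  qed
  ultimately have "card ?F = CARD('k)" using card_image[of ?f ?F] by simp
  then have "CARD('q) ^ card B = CARD('q) ^ t"
    by (simp add: card_PiE card_ext)
  then show ?thesis using card_base_gt_1 by (simp add: power_inject_exp)
qed

lemma extend_to_basis:
  assumes "V.independent S"
  obtains B where "S \<subseteq> B" "V.independent B" "V.span B = UNIV" "card B = t"
proof -
  obtain B where "S \<subseteq> B" "B \<subseteq> UNIV" "V.independent B" "UNIV \<subseteq> V.span B"
    using V.maximal_independent_subset_extend[OF _ assms, of UNIV] by auto
  with that card_spanning_independent show ?thesis by blast
qed

text \<open>The value outside \<open>B\<close> is frozen, so that the coordinate functions lie in a
  finite extensional function space that can be counted.\<close>

definition trace_coords :: "'k set \<Rightarrow> 'k \<Rightarrow> 'k \<Rightarrow> 'q" where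
  "trace_coords B y = (\<lambda>b\<in>B. Tr (y * b))"

lemma bij_trace_coords:
  assumes B: "V.independent B" "V.span B = UNIV"
  shows "bij_betw (trace_coords B) UNIV (B \<rightarrow>\<^sub>E UNIV)"
proof -
  have inj: "inj (trace_coords B)"
  proof (rule injI)
    fix y z assume eq: "trace_coords B y = trace_coords B z"
    have *: "Tr ((y - z) * b) = 0" if "b \<in> B" for b
      using fun_cong[OF eq, of b] that by (simp add: trace_coords_def Tr_diff left_diff_distrib)
    \<comment> \<open>Being orthogonal to the basis means being orthogonal to everything, by
      expanding \<open>x\<close> in \<open>B\<close>; nondegeneracy then applies.\<close>
    have "Tr (x * (y - z)) = 0" for x
    proof -
      have "x \<in> V.span B" using B by simp
      then obtain u where "x = (\<Sum>b\<in>B. ext_scale emb (u b) b)" by (auto simp: V.span_finite)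
      then have "Tr (x * (y - z)) = (\<Sum>b\<in>B. Tr (emb (u b) * ((y - z) * b)))"
        by (simp add: ext_scale_def sum_distrib_right sum_distrib_left Tr_sum mult_ac)
      then show ?thesis by (simp add: Tr_scale *)
    qed
    then have "y - z = 0" by (rule Tr_nondegenerate)
    then show "y = z" by simp
  qed
  have "trace_coords B ` UNIV = (B \<rightarrow>\<^sub>E UNIV)"
  proof (rule card_seteq)
    show "trace_coords B ` UNIV \<subseteq> (B \<rightarrow>\<^sub>E UNIV)" by (auto simp: trace_coords_def)
    have "card (B \<rightarrow>\<^sub>E (UNIV :: 'q set)) = CARD('k)"
      by (simp add: card_PiE card_ext card_spanning_independent[OF B])
    then show "card (B \<rightarrow>\<^sub>E (UNIV :: 'q set)) \<le> card (trace_coords B ` UNIV)"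
      using inj by (simp add: card_image)
  qed (auto intro: finite_PiE)
  with inj show ?thesis by (simp add: bij_betw_def)
qed

text \<open>Extend \<open>S\<close> to a basis: in trace coordinates the values on \<open>S\<close>
  are prescribed and the remaining \<open>t - card S\<close> coordinates are free.\<close>

lemma card_trace_fibre:
  assumes "V.independent S"
  shows "card {y. \<forall>b\<in>S. Tr (y * b) = w b} = CARD('q) ^ (t - card S)"
proof -
  obtain B where B: "S \<subseteq> B" "V.independent B" "V.span B = UNIV" "card B = t"
    using extend_to_basis[OF assms] .
  let ?E = "PiE B (\<lambda>b. if b \<in> S then {w b} else UNIV)"
  have bij: "bij_betw (trace_coords B) UNIV (B \<rightarrow>\<^sub>E UNIV)"
    using B by (intro bij_trace_coords)
  have "trace_coords B ` {y. \<forall>b\<in>S. Tr (y * b) = w b} = ?E"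
  proof (intro equalityI subsetI)
    fix g assume "g \<in> trace_coords B ` {y. \<forall>b\<in>S. Tr (y * b) = w b}"
    then show "g \<in> ?E" by (auto simp: trace_coords_def)
  next
    fix g assume g: "g \<in> ?E"
    then have "g \<in> B \<rightarrow>\<^sub>E UNIV" by (auto simp: PiE_def)
    then have "g \<in> range (trace_coords B)" using bij by (simp add: bij_betw_def)
    then obtain y where y: "g = trace_coords B y" by auto
    have "Tr (y * b) = w b" if "b \<in> S" for b
    proof -
      have "b \<in> B" using that B by auto
      then have "g b \<in> {w b}" using PiE_mem[OF g, of b] that by simp
      then show ?thesis using \<open>b \<in> B\<close> by (simp add: y trace_coords_def)
    qed
    then show "g \<in> trace_coords B ` {y. \<forall>b\<in>S. Tr (y * b) = w b}" using y by auto
  qed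
  moreover have "inj_on (trace_coords B) {y. \<forall>b\<in>S. Tr (y * b) = w b}"
    using bij by (auto simp: bij_betw_def intro: inj_on_subset)
  ultimately have "card {y. \<forall>b\<in>S. Tr (y * b) = w b} = card ?E"
    using card_image[of "trace_coords B" "{y. \<forall>b\<in>S. Tr (y * b) = w b}"] by simp
  also have "\<dots> = (\<Prod>b\<in>B. if b \<in> S then 1 else CARD('q))"
    by (auto simp: card_PiE intro!: prod.cong)
  also have "\<dots> = (\<Prod>b\<in>B - S. CARD('q))"
    by (intro prod.mono_neutral_cong_right) auto
  also have "\<dots> = CARD('q) ^ (t - card S)"
    using B by (simp add: card_Diff_subset)
  finally show ?thesis .
qed

text \<open>A linear relation on \<open>S\<close> is inherited by every right-hand side
  \<open>w\<close> that has a solution. The indicator of an element with nonzero coefficient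
  violates it.\<close>

lemma independent_if_traces_surj:
  assumes surj: "\<And>w. \<exists>y. \<forall>b\<in>S. Tr (y * b) = w b"
  shows "V.independent S"
proof
  assume "V.dependent S"
  then obtain u v where u: "(\<Sum>b\<in>S. ext_scale emb (u b) b) = 0" "v \<in> S" "u v \<noteq> 0"
    using V.dependent_finite[of S] by auto
  obtain y where y: "\<forall>b\<in>S. Tr (y * b) = (if b = v then 1 else 0)"
    using surj[of "\<lambda>b. if b = v then 1 else 0"] by blast
  have "0 = Tr (y * (\<Sum>b\<in>S. ext_scale emb (u b) b))" using u by simp
  also have "\<dots> = (\<Sum>b\<in>S. Tr (emb (u b) * (y * b)))"
    by (simp add: ext_scale_def sum_distrib_left Tr_sum mult_ac)
  also have "\<dots> = (\<Sum>b\<in>S. u b * (if b = v then 1 else 0))"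
    using y by (simp add: Tr_scale)
  also have "\<dots> = (\<Sum>b\<in>S. if b = v then u b else 0)" by (intro sum.cong) auto
  also have "\<dots> = u v" using u(2) by simp
  finally show False using u by simp
qed

text \<open>With \<open>t\<close> equations the fibre over 0 has one element if \<open>S\<close> is
  independent. Conversely a trivial kernel makes \<open>trace_coords S\<close> injective, hence
  surjective by counting, and \<open>independent_if_traces_surj\<close> applies.\<close>

lemma independent_iff_traces_inj:
  assumes "card S = t"
  shows "V.independent S \<longleftrightarrow> (\<forall>y. (\<forall>b\<in>S. Tr (y * b) = 0) \<longrightarrow> y = 0)"
proof
  assume "V.independent S"
  then have "card {y. \<forall>b\<in>S. Tr (y * b) = 0} = 1"
    using card_trace_fibre[of S "\<lambda>_. 0"] assms by simp
  then obtain z where z: "{y. \<forall>b\<in>S. Tr (y * b) = 0} = {z}" by (auto simp: card_1_singleton_iff)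
  have "0 \<in> {y. \<forall>b\<in>S. Tr (y * b) = 0}" by simp
  then have "z = 0" unfolding z by simp
  with z have "{y. \<forall>b\<in>S. Tr (y * b) = 0} = {0}" by simp
  then show "\<forall>y. (\<forall>b\<in>S. Tr (y * b) = 0) \<longrightarrow> y = 0"
    unfolding set_eq_iff by simp
next
  assume *: "\<forall>y. (\<forall>b\<in>S. Tr (y * b) = 0) \<longrightarrow> y = 0"
  have inj: "inj (trace_coords S)"
  proof (rule injI)
    fix y z assume eq: "trace_coords S y = trace_coords S z"
    have "Tr ((y - z) * b) = 0" if "b \<in> S" for b
      using fun_cong[OF eq, of b] that by (simp add: trace_coords_def Tr_diff left_diff_distrib)
    then have "y - z = 0" using * by blast
    then show "y = z" by simp
  qed
  have surj: "range (trace_coords S) = (S \<rightarrow>\<^sub>E UNIV)"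
  proof (rule card_seteq)
    show "trace_coords S ` UNIV \<subseteq> (S \<rightarrow>\<^sub>E UNIV)" by (auto simp: trace_coords_def)
    show "card (S \<rightarrow>\<^sub>E (UNIV :: 'q set)) \<le> card (trace_coords S ` UNIV)"
      using inj by (simp add: card_image card_PiE card_ext assms)
  qed (auto intro: finite_PiE)
  show "V.independent S"
  proof (rule independent_if_traces_surj)
    fix w :: "'k \<Rightarrow> 'q"
    have "restrict w S \<in> range (trace_coords S)"
      using surj by simp
    then obtain y where y: "trace_coords S y = restrict w S" by auto
    have "Tr (y * b) = w b" if "b \<in> S" for b
      using fun_cong[OF y, of b] that by (simp add: trace_coords_def)
    then show "\<exists>y. \<forall>b\<in>S. Tr (y * b) = w b" by blast
  qed
qed

section \<open>Linear relations between powers and the minimal polynomial\<close>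

text \<open>Translates coefficients attached to vectors into coefficients attached to indices, as
  statement 4 has them. Injectivity ensures that each vector carries one index only.\<close>

lemma independent_image_iff:
  assumes inj: "inj_on f J" and fin: "finite J"
  shows "V.independent (f ` J) \<longleftrightarrow>
    (\<forall>d. (\<exists>j\<in>J. d j \<noteq> 0) \<longrightarrow> (\<Sum>j\<in>J. emb (d j) * f j) \<noteq> 0)" (is "?L \<longleftrightarrow> ?R")
proof
  assume L: ?L
  show ?R
  proof (intro allI impI notI)
    fix d :: "_ \<Rightarrow> 'q"
    assume "\<exists>j\<in>J. d j \<noteq> 0" and *: "(\<Sum>j\<in>J. emb (d j) * f j) = 0"
    then obtain j where j: "j \<in> J" "d j \<noteq> 0" by blast
    let ?u = "\<lambda>x. d (the_inv_into J f x)"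
    have "(\<Sum>x\<in>f ` J. ext_scale emb (?u x) x) = 0"
      using * inj by (simp add: sum.reindex ext_scale_def the_inv_into_f_f cong: sum.cong)
    then have "?u (f j) = 0"
      by (rule V.independentD[OF L finite subset_refl]) (use j in auto)
    then show False using j inj by (simp add: the_inv_into_f_f)
  qed
next
  assume R: ?R
  show ?L
  proof
    assume "V.dependent (f ` J)"
    then obtain u where u: "\<exists>v\<in>f ` J. u v \<noteq> 0" "(\<Sum>v\<in>f ` J. ext_scale emb (u v) v) = 0"
      using V.dependent_finite[of "f ` J"] by auto
    have "(\<Sum>j\<in>J. emb (u (f j)) * f j) = 0"
      using u(2) inj by (simp add: sum.reindex ext_scale_def)
    moreover have "\<exists>j\<in>J. (u \<circ> f) j \<noteq> 0" using u(1) by auto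
    ultimately show False using R[rule_format, of "u \<circ> f"] by simp
  qed
qed

text \<open>The remainder modulo the minimal polynomial has the same value at \<open>a\<close> and
  is zero or of smaller degree; by minimality it vanishes as soon as its value does.\<close>

lemma minimal_poly_dvd_iff:
  "minimal_poly emb a dvd p \<longleftrightarrow> poly (map_poly emb p) a = 0"
proof -
  interpret hp: map_poly_comm_ring_hom emb ..
  let ?m = "minimal_poly emb a"
  have m: "lead_coeff ?m = 1" "poly (map_poly emb ?m) a = 0"
    "\<And>r. r \<noteq> 0 \<Longrightarrow> poly (map_poly emb r) a = 0 \<Longrightarrow> degree ?m \<le> degree r"
    using theI'[OF minimal_poly_unique[OF field_hom_axioms, of a], folded minimal_poly_def] by auto
  then have nz: "?m \<noteq> 0" by auto
  have "map_poly emb p = map_poly emb (p div ?m * ?m + p mod ?m)"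
    by (simp only: div_mult_mod_eq)
  also have "\<dots> = map_poly emb (p div ?m) * map_poly emb ?m + map_poly emb (p mod ?m)"
    by (simp only: hp.hom_add hp.hom_mult)
  finally have eq: "poly (map_poly emb p) a = poly (map_poly emb (p mod ?m)) a"
    using m(2) by simp
  show ?thesis
  proof
    assume "?m dvd p"
    then show "poly (map_poly emb p) a = 0" using eq by (simp add: mod_eq_0_iff_dvd)
  next
    assume "poly (map_poly emb p) a = 0"
    then have "poly (map_poly emb (p mod ?m)) a = 0" using eq by simp
    then have "p mod ?m = 0" using m(3) degree_mod_less[OF nz, of p] by fastforce
    then show "?m dvd p" by (simp add: mod_eq_0_iff_dvd)
  qed
qed

lemma poly_map_sum_monom:
  "poly (map_poly emb (\<Sum>j\<in>J. monom (d j) (i j))) a = (\<Sum>j\<in>J. emb (d j) * a ^ i j)"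
proof -
  interpret hp: map_poly_comm_ring_hom emb ..
  show ?thesis by (simp add: hp.hom_sum map_poly_monom poly_sum poly_monom)
qed

section \<open>Flats of the projective space\<close>

text \<open>If \<open>x\<close> and some \<open>y\<close> in \<open>U\<close> span the same point,
  then \<open>x\<close> is in the span of \<open>y\<close>, which \<open>U\<close> contains.\<close>

lemma proj_point_mem_iff:
  assumes "V.subspace U" and "x \<noteq> 0"
  shows "proj_point emb x \<in> proj_point emb ` (U - {0}) \<longleftrightarrow> x \<in> U"
proof
  assume "proj_point emb x \<in> proj_point emb ` (U - {0})"
  then obtain y where "y \<in> U" "V.span {x} = V.span {y}" by (auto simp: proj_point_def)
  then have "x \<in> V.span {y}" using V.span_base[of x "{x}"] by simp
  then show "x \<in> U" using V.span_minimal[of "{y}" U] assms(1) \<open>y \<in> U\<close> by auto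
qed (use assms in auto)

text \<open>An (s-2)-flat comes from a subspace of dimension s-1. Such a subspace has no room for s
  independent vectors, while a dependent set of size s spans at most s-1 dimensions and its span can
  be enlarged to exactly s-1.\<close>

lemma independent_iff_no_flat:
  assumes "0 \<notin> S" "card S = s" "1 \<le> s" "s \<le> t"
  shows "V.independent S \<longleftrightarrow> \<not> (\<exists>P. is_flat emb (int s - 2) P \<and> proj_point emb ` S \<subseteq> P)"
proof -
  have mem: "proj_point emb ` S \<subseteq> proj_point emb ` (U - {0}) \<longleftrightarrow> S \<subseteq> U"
    if "V.subspace U" for U
    unfolding image_subset_iff subset_eq[of S U]
  proof (rule ball_cong[OF refl])
    fix x assume "x \<in> S"
    then have "x \<noteq> 0" using assms(1) by auto
    then show "proj_point emb x \<in> proj_point emb ` (U - {0}) \<longleftrightarrow> x \<in> U"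
      by (rule proj_point_mem_iff[OF that])
  qed
  have *: "(\<exists>P. is_flat emb (int s - 2) P \<and> proj_point emb ` S \<subseteq> P) \<longleftrightarrow>
    (\<exists>U. V.subspace U \<and> V.dim U = s - 1 \<and> S \<subseteq> U)"
  proof -
    \<comment> \<open>Since s is at least 1, the subtraction in \<nat> is not truncated; s = 1 gives
      the zero subspace and the empty flat.\<close>
    have dim: "int (V.dim U) = int s - 2 + 1 \<longleftrightarrow> V.dim U = s - 1" for U
      using assms(3) by linarith
    have "(\<exists>P. is_flat emb (int s - 2) P \<and> proj_point emb ` S \<subseteq> P) \<longleftrightarrow>
      (\<exists>U. V.subspace U \<and> int (V.dim U) = int s - 2 + 1 \<and>
        proj_point emb ` S \<subseteq> proj_point emb ` (U - {0}))"
      unfolding is_flat_def by metis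
    also have "\<dots> \<longleftrightarrow> (\<exists>U. V.subspace U \<and> V.dim U = s - 1 \<and> S \<subseteq> U)"
      unfolding dim by (rule ex_cong1, rule conj_cong[OF refl]) (simp only: mem)
    finally show ?thesis .
  qed
  have "V.dependent S \<longleftrightarrow> (\<exists>U. V.subspace U \<and> V.dim U = s - 1 \<and> S \<subseteq> U)"
  proof
    assume dep: "V.dependent S"
    obtain A where A: "A \<subseteq> S" "V.independent A" "S \<subseteq> V.span A"
      using V.maximal_independent_subset[of S] .
    have "A \<noteq> S" using dep A by auto
    then have "card A < s" using A assms(2) psubset_card_mono[of S A] by auto
    obtain B where B: "A \<subseteq> B" "V.independent B" "V.span B = UNIV" "card B = t"
      using extend_to_basis[OF A(2)] .
    have "card A \<le> s - 1" "s - 1 \<le> card B"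
      using \<open>card A < s\<close> assms(4) B(4) by linarith+
    \<comment> \<open>\<open>A\<close> is padded with vectors of the basis \<open>B\<close> to size
      exactly \<open>s - 1\<close>; there are enough of them because s \<le> t.\<close>
    then obtain C where C: "A \<subseteq> C" "C \<subseteq> B" "card C = s - 1"
      using exists_subset_between[of A "s - 1" B] B(1) by auto
    have "V.dim (V.span C) = s - 1"
      using V.dim_span_eq_card_independent[of C] V.independent_mono[OF B(2) C(2)] C(3) by simp
    moreover have "S \<subseteq> V.span C" using A(3) V.span_mono[OF C(1)] by blast
    ultimately show "\<exists>U. V.subspace U \<and> V.dim U = s - 1 \<and> S \<subseteq> U"
      using V.subspace_span by blast
  next
    assume "\<exists>U. V.subspace U \<and> V.dim U = s - 1 \<and> S \<subseteq> U"
    then obtain U where U: "V.subspace U" "V.dim U = s - 1" "S \<subseteq> U" by blast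
    show "V.dependent S"
    proof (rule ccontr)
      assume indep: "V.independent S"
      obtain B where B: "B \<subseteq> U" "V.independent B" "U \<subseteq> V.span B" "card B = V.dim U"
        using V.basis_exists[of U] .
      have "card S \<le> card B"
        using V.independent_span_bound[OF finite indep, of B] U(3) B(3) by auto
      then show False using B(4) U(2) assms by linarith
    qed
  qed
  then show ?thesis using * by blast
qed

section \<open>Windows of the trace sequence\<close>

text \<open>\<open>W\<close> is linear and injective, so it preserves and reflects dependence. The
  two sides use different formalizations of linear dependence, which are matched through explicit
  finite combinations.\<close>

lemma lin_dep_trace_windows_iff:
  fixes \<alpha> :: 'k
  assumes "primitive_element \<alpha>"
  defines "N \<equiv> CARD('q) ^ t - 1"
  defines "W \<equiv> \<lambda>x. vec N (\<lambda>k. Tr (\<alpha> ^ k * x))"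
  shows "LinearCombinations.module.lin_dep class_ring (module_vec TYPE('q) N) (W ` S) \<longleftrightarrow>
    V.dependent S"
proof -
  interpret VS: vec_space "TYPE('q)" N .
  have powers: "bij_betw (\<lambda>k. \<alpha> ^ k) {..<N} (UNIV - {0})"
    using bij_betw_primitive_powers[OF assms(1)] by (simp add: N_def card_ext)
  \<comment> \<open>A window of length \<open>N\<close> meets every power of \<alpha>, so a zero
    window says that x is orthogonal to all nonzero y.\<close>
  have W0: "x = 0" if "W x = 0\<^sub>v N" for x
  proof (rule Tr_nondegenerate)
    fix y
    show "Tr (y * x) = 0"
    proof (cases "y = 0")
      case False
      then have "y \<in> (\<lambda>k. \<alpha> ^ k) ` {..<N}" using powers by (simp add: bij_betw_def)
      then obtain k where k: "y = \<alpha> ^ k" "k < N" by auto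
      have "W x $ k = 0" using that k by simp
      then show ?thesis using k by (simp add: W_def)
    qed simp
  qed
  have W_diff: "W (x - y) = W x - W y" for x y
    by (auto simp: W_def right_diff_distrib Tr_diff)
  have inj: "inj_on W A" for A
  proof (rule inj_onI)
    fix x y assume "W x = W y"
    then have "W (x - y) = 0\<^sub>v N" by (simp add: W_diff) (simp add: W_def)
    then show "x = y" using W0 by fastforce
  qed
  have carr: "W ` S \<subseteq> carrier_vec N" by (auto simp: W_def)
  have lincomb: "VS.lincomb a (W ` S) = W (\<Sum>x\<in>S. ext_scale emb (a (W x)) x)" for a
  proof (rule eq_vecI)
    show "dim_vec (VS.lincomb a (W ` S)) = dim_vec (W (\<Sum>x\<in>S. ext_scale emb (a (W x)) x))"
      using VS.lincomb_dim[OF _ carr, of a] by (simp add: W_def)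
  next
    fix k assume "k < dim_vec (W (\<Sum>x\<in>S. ext_scale emb (a (W x)) x))"
    then have k: "k < N" by (simp add: W_def)
    have "VS.lincomb a (W ` S) $ k = (\<Sum>x\<in>S. a (W x) * W x $ k)"
      by (simp add: VS.lincomb_index[OF k carr] sum.reindex[OF inj])
    also have "\<dots> = (\<Sum>x\<in>S. Tr (emb (a (W x)) * (\<alpha> ^ k * x)))"
      using k by (simp add: W_def Tr_scale)
    also have "\<dots> = W (\<Sum>x\<in>S. ext_scale emb (a (W x)) x) $ k"
      using k by (simp add: W_def ext_scale_def sum_distrib_left Tr_sum mult_ac)
    finally show "VS.lincomb a (W ` S) $ k = W (\<Sum>x\<in>S. ext_scale emb (a (W x)) x) $ k" .
  qed
  show ?thesis
  proof
    assume "VS.lin_dep (W ` S)"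
    then have "\<exists>a v. VS.lincomb a (W ` S) = 0\<^sub>v N \<and> v \<in> W ` S \<and> a v \<noteq> 0"
      using VS.finite_lin_dep[of "W ` S"] carr by auto
    then obtain a v where av: "VS.lincomb a (W ` S) = 0\<^sub>v N" "v \<in> W ` S" "a v \<noteq> 0"
      by blast
    have "(\<Sum>x\<in>S. ext_scale emb (a (W x)) x) = 0"
      by (rule W0) (use av(1) lincomb[of a] in simp)
    moreover have "\<exists>x\<in>S. a (W x) \<noteq> 0" using av by auto
    ultimately show "V.dependent S"
      unfolding V.dependent_finite[OF finite] by (intro exI[of _ "\<lambda>x. a (W x)"] conjI)
  next
    assume "V.dependent S"
    then obtain u x where u: "(\<Sum>x\<in>S. ext_scale emb (u x) x) = 0" "x \<in> S" "u x \<noteq> 0"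
      using V.dependent_finite[of S] by auto
    \<comment> \<open>Coefficients on vectors \<open>W x\<close> are read off from those on
      \<open>x\<close>, which is legitimate because \<open>W\<close> is injective.\<close>
    let ?a = "\<lambda>v. u (inv_into UNIV W v)"
    have inv_W: "inv_into UNIV W (W x) = x" for x using inj by simp
    have "W 0 = 0\<^sub>v N" by (auto simp: W_def)
    then have "VS.lincomb ?a (W ` S) = 0\<^sub>v N" using u(1) by (simp add: lincomb inv_W)
    then show "VS.lin_dep (W ` S)"
      using u by (intro VS.lin_dep_crit[where A = "W ` S" and a = ?a and v = "W x"]) (auto simp: inv_W)
  qed
qed

section \<open>The arrays\<close>

text \<open>Rows are indexed bijectively by field elements y, so counting rows with prescribed
  entries is counting solutions of a trace system.\<close>

lemma card_trace_array0_rows: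
  fixes \<alpha> :: 'k and i :: "nat \<Rightarrow> nat"
  assumes "primitive_element \<alpha>"
  shows "card {r. r < CARD('q) ^ t \<and> (\<forall>c<s. trace_array0 emb t \<alpha> s i $$ (r, c) = w c)} =
    card {y. \<forall>c<s. Tr (y * \<alpha> ^ i c) = w c}"
proof -
  define N where "N = CARD('q) ^ t - 1"
  have qt: "CARD('q) ^ t = Suc N" using card_base_gt_1 by (simp add: N_def)
  have powers: "bij_betw (\<lambda>k. \<alpha> ^ k) {..<N} (UNIV - {0})"
    using bij_betw_primitive_powers[OF assms] by (simp add: N_def card_ext)
  \<comment> \<open>Row \<open>r\<close> belongs to the power \<open>r\<close> of \<alpha>; the last
    index \<open>N\<close> is the appended zero row and belongs to y = 0.\<close>
  define f where "f r = (if r < N then \<alpha> ^ r else 0)" for r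
  have entry: "trace_array0 emb t \<alpha> s i $$ (r, c) = Tr (f r * \<alpha> ^ i c)" if "r < Suc N" "c < s" for r c
    using that by (auto simp: trace_array0_def trace_array_def append_rows_def f_def N_def power_add)
  have "bij_betw f {..<N} (UNIV - {0})"
    using powers by (rule bij_betw_cong[THEN iffD1, rotated]) (simp add: f_def)
  moreover have "bij_betw f {N} {0}" by (simp add: f_def)
  ultimately have "bij_betw f ({..<N} \<union> {N}) (UNIV - {0} \<union> {0})"
    by (rule bij_betw_combine) simp
  then have f: "bij_betw f {..<Suc N} UNIV" by (simp add: lessThan_Suc insert_commute)
  have "bij_betw f {r. r < Suc N \<and> (\<forall>c<s. trace_array0 emb t \<alpha> s i $$ (r, c) = w c)}
      {y. \<forall>c<s. Tr (y * \<alpha> ^ i c) = w c}"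
  proof (rule bij_betw_subset[OF f])
    show "f ` {r. r < Suc N \<and> (\<forall>c<s. trace_array0 emb t \<alpha> s i $$ (r, c) = w c)} =
      {y. \<forall>c<s. Tr (y * \<alpha> ^ i c) = w c}"
    proof (intro equalityI subsetI)
      fix y assume y: "y \<in> {y. \<forall>c<s. Tr (y * \<alpha> ^ i c) = w c}"
      have "y \<in> f ` {..<Suc N}" using f by (simp add: bij_betw_def)
      then obtain r where "y = f r" "r < Suc N" by auto
      with y show "y \<in> f ` {r. r < Suc N \<and> (\<forall>c<s. trace_array0 emb t \<alpha> s i $$ (r, c) = w c)}"
        by (auto simp: entry)
    qed (auto simp: entry)
  qed auto
  then show ?thesis unfolding qt by (rule bij_betw_same_card)
qed

text \<open>The array property says that every trace system has \<open>CARD('q) ^ (t - s)\<close>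
  solutions. Independence gives this by \<open>card_trace_fibre\<close>; conversely the count is
  positive, so every system is solvable.\<close>

lemma orthogonal_array_trace_array0_iff:
  fixes \<alpha> :: 'k and i :: "nat \<Rightarrow> nat"
  assumes prim: "primitive_element \<alpha>" and inj: "inj_on (\<lambda>j. \<alpha> ^ i j) {..<s}" and "s \<le> t"
  shows "orthogonal_array (UNIV :: 'q set) (CARD('q) ^ (t - s)) s s CARD('q)
      (trace_array0 emb t \<alpha> s i) \<longleftrightarrow> V.independent ((\<lambda>j. \<alpha> ^ i j) ` {..<s})"
    (is "?OA \<longleftrightarrow> V.independent ?S")
proof -
  have rows: "dim_row (trace_array0 emb t \<alpha> s i) = CARD('q) ^ t"
    using card_base_gt_1 by (simp add: trace_array0_def trace_array_def append_rows_def)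
  have cols: "dim_col (trace_array0 emb t \<alpha> s i) = s"
    by (simp add: trace_array0_def trace_array_def append_rows_def)
  \<comment> \<open>Strength and number of columns coincide, so the set of all columns is the only
    choice.\<close>
  have full: "C \<subseteq> {..<s} \<and> card C = s \<longleftrightarrow> C = {..<s}" for C :: "nat set"
    using card_subset_eq[of "{..<s}" C] by auto
  have pow: "CARD('q) ^ (t - s) * CARD('q) ^ s = CARD('q) ^ t"
    using \<open>s \<le> t\<close> by (simp flip: power_add)
  have "?OA \<longleftrightarrow> (\<forall>w. card {r. r < CARD('q) ^ t \<and>
      (\<forall>c<s. trace_array0 emb t \<alpha> s i $$ (r, c) = w c)} = CARD('q) ^ (t - s))"
    unfolding orthogonal_array_def rows cols pow
    by (simp add: conj_assoc[symmetric] full) (simp add: lessThan_iff Ball_def)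
  also have "\<dots> \<longleftrightarrow> (\<forall>w. card {y. \<forall>c<s. Tr (y * \<alpha> ^ i c) = w c} = CARD('q) ^ (t - s))"
    by (simp only: card_trace_array0_rows[OF prim])
  also have "\<dots> \<longleftrightarrow> V.independent ?S"
  proof
    assume *: "\<forall>w. card {y. \<forall>c<s. Tr (y * \<alpha> ^ i c) = w c} = CARD('q) ^ (t - s)"
    show "V.independent ?S"
    proof (rule independent_if_traces_surj)
      fix w :: "'k \<Rightarrow> 'q"
      have "card {y. \<forall>c<s. Tr (y * \<alpha> ^ i c) = w (\<alpha> ^ i c)} > 0"
        using *[rule_format, of "\<lambda>c. w (\<alpha> ^ i c)"] by simp
      then have "{y. \<forall>c<s. Tr (y * \<alpha> ^ i c) = w (\<alpha> ^ i c)} \<noteq> {}" by (metis card.empty less_irrefl)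
      then show "\<exists>y. \<forall>b\<in>?S. Tr (y * b) = w b" by auto
    qed
  next
    assume indep: "V.independent ?S"
    show "\<forall>w. card {y. \<forall>c<s. Tr (y * \<alpha> ^ i c) = w c} = CARD('q) ^ (t - s)"
    proof
      fix w :: "nat \<Rightarrow> 'q"
      \<comment> \<open>The tuple \<open>w\<close> is indexed by columns; the inverse of the
        injective column map reindexes it by vectors.\<close>
      have "{y. \<forall>c<s. Tr (y * \<alpha> ^ i c) = w c} =
          {y. \<forall>b\<in>?S. Tr (y * b) = w (the_inv_into {..<s} (\<lambda>j. \<alpha> ^ i j) b)}"
        using the_inv_into_f_f[OF inj] by auto
      then show "card {y. \<forall>c<s. Tr (y * \<alpha> ^ i c) = w c} = CARD('q) ^ (t - s)"
        using card_trace_fibre[OF indep] by (simp add: card_image[OF inj])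
    qed
  qed
  finally show ?thesis .
qed

text \<open>Without the appended row, the rows run through the nonzero y only, so a zero row is a
  nontrivial solution of the homogeneous system.\<close>

lemma zero_row_trace_array_iff:
  fixes \<alpha> :: 'k and i :: "nat \<Rightarrow> nat"
  assumes prim: "primitive_element \<alpha>"
  shows "(\<exists>r < dim_row (trace_array emb t \<alpha> s i). row (trace_array emb t \<alpha> s i) r = 0\<^sub>v s) \<longleftrightarrow>
    (\<exists>y. y \<noteq> 0 \<and> (\<forall>b\<in>(\<lambda>j. \<alpha> ^ i j) ` {..<s}. Tr (y * b) = 0))"
proof -
  define N where "N = CARD('q) ^ t - 1"
  have powers: "bij_betw (\<lambda>k. \<alpha> ^ k) {..<N} (UNIV - {0})"
    using bij_betw_primitive_powers[OF prim] by (simp add: N_def card_ext)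
  have N: "dim_row (trace_array emb t \<alpha> s i) = N" by (simp add: trace_array_def N_def)
  have row: "row (trace_array emb t \<alpha> s i) r = 0\<^sub>v s \<longleftrightarrow> (\<forall>j<s. Tr (\<alpha> ^ r * \<alpha> ^ i j) = 0)"
    if "r < N" for r
    using that by (auto simp: vec_eq_iff trace_array_def N_def power_add)
  have "(\<exists>y. y \<noteq> 0 \<and> (\<forall>j<s. Tr (y * \<alpha> ^ i j) = 0)) \<longleftrightarrow>
      (\<exists>y\<in>(\<lambda>k. \<alpha> ^ k) ` {..<N}. \<forall>j<s. Tr (y * \<alpha> ^ i j) = 0)"
    using powers by (auto simp: bij_betw_def)
  also have "\<dots> \<longleftrightarrow> (\<exists>r<N. row (trace_array emb t \<alpha> s i) r = 0\<^sub>v s)"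
    using row by auto
  finally have "(\<exists>r<N. row (trace_array emb t \<alpha> s i) r = 0\<^sub>v s) \<longleftrightarrow>
      (\<exists>y. y \<noteq> 0 \<and> (\<forall>j<s. Tr (y * \<alpha> ^ i j) = 0))" ..
  moreover have "(\<forall>b\<in>(\<lambda>j. \<alpha> ^ i j) ` {..<s}. Tr (y * b) = 0) \<longleftrightarrow>
      (\<forall>j<s. Tr (y * \<alpha> ^ i j) = 0)" for y
    by auto
  ultimately show ?thesis unfolding N by simp
qed

end

section \<open>Reduction of all statements to independence of the powers\<close>

theorem mainTheorem6:
  fixes emb :: "'q::finite_field \<Rightarrow> 'k::finite_field"
    and q t s :: nat
    and \<alpha> :: 'k
    and I :: "nat set"
    and i :: "nat \<Rightarrow> nat"
  assumes "primepow q"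
    and "CARD('q) = q"
    and "CARD('k) = q ^ t"
    and "field_hom emb"
    and "1 \<le> t" and "1 \<le> s" and "s \<le> t"
    and "primitive_element \<alpha>"
    and "I \<subseteq> {0..q ^ t - 2}"
    and "card I = s"
    and "I = i ` {..<s}"
  defines "S1 \<equiv> orthogonal_array (UNIV :: 'q set) (q ^ (t - s)) s s q (trace_array0 emb t \<alpha> s i)"
    and "S2 \<equiv> \<not> Modules.module.dependent (ext_scale emb) {\<alpha> ^ i j | j. j < s}"
    and "S3 \<equiv> \<not> LinearCombinations.module.lin_dep class_ring (module_vec TYPE('q) (q ^ t - 1))
                 {seq_window (q ^ t - 1) (i j) (trace_seq emb t \<alpha>) | j. j < s}"
    and "S4 \<equiv> \<forall>d :: nat \<Rightarrow> 'q. (\<exists>j<s. d j \<noteq> 0) \<longrightarrow>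
                 \<not> minimal_poly emb \<alpha> dvd (\<Sum>j<s. Polynomial.monom (d j) (i j))"
    and "S5 \<equiv> \<not> (\<exists>P. is_flat emb (int s - 2) P \<and> (\<forall>j<s. proj_point emb (\<alpha> ^ i j) \<in> P))"
    and "S6 \<equiv> \<not> (\<exists>r < dim_row (trace_array emb t \<alpha> s i). row (trace_array emb t \<alpha> s i) r = 0\<^sub>v s)"
  shows "(S1 \<longleftrightarrow> S2) \<and> (S2 \<longleftrightarrow> S3) \<and> (S3 \<longleftrightarrow> S4) \<and> (S4 \<longleftrightarrow> S5) \<and> (s = t \<longrightarrow> (S5 \<longleftrightarrow> S6))"
proof -
  interpret emb: field_hom emb by fact
  interpret E: finite_field_extension emb t
    by unfold_locales (use assms in auto)
  let ?f = "\<lambda>j. \<alpha> ^ i j"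
  let ?S = "?f ` {..<s}"
  have q: "q = CARD('q)" using assms by simp
  have S: "{\<alpha> ^ i j | j. j < s} = ?S" by auto
  \<comment> \<open>As \<open>I\<close> has \<open>s\<close> elements, its enumeration by
    \<open>s\<close> indices has no repetition.\<close>
  have "inj_on i {..<s}" using assms by (intro eq_card_imp_inj_on) auto
  moreover have "inj_on (\<lambda>k. \<alpha> ^ k) (i ` {..<s})"
  proof (rule inj_on_subset)
    show "inj_on (\<lambda>k. \<alpha> ^ k) {..<CARD('k) - 1}"
      using bij_betw_primitive_powers[OF \<open>primitive_element \<alpha>\<close>] by (simp add: bij_betw_def)
    \<comment> \<open>This makes the bound \<open>q ^ t - 2\<close> on \<open>I\<close> lie strictly
      below \<open>q ^ t - 1\<close> despite truncated subtraction, so the exponents fall in the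
      range where powers are distinct.\<close>
    have "q ^ t > 1" using E.card_base_gt_1 assms by (intro one_less_power) auto
    then have "k < CARD('k) - 1" if "k \<in> I" for k
      using assms(3) subsetD[OF \<open>I \<subseteq> {0..q ^ t - 2}\<close> that] by simp
    then show "i ` {..<s} \<subseteq> {..<CARD('k) - 1}" using \<open>I = i ` {..<s}\<close> by auto
  qed
  ultimately have inj: "inj_on ?f {..<s}"
    using comp_inj_on[of i "{..<s}" "\<lambda>k. \<alpha> ^ k"] by (simp add: comp_def)
  then have card: "card ?S = s" by (simp add: card_image)
  have S1: "S1 \<longleftrightarrow> E.V.independent ?S"
    unfolding S1_def q
    by (rule E.orthogonal_array_trace_array0_iff[OF \<open>primitive_element \<alpha>\<close> inj \<open>s \<le> t\<close>])
  have S2: "S2 \<longleftrightarrow> E.V.independent ?S" unfolding S2_def S ..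
  \<comment> \<open>Splitting the power with exponent \<open>k + i j\<close> into a product shows
    each window as the image of the vector \<open>\<alpha> ^ i j\<close> under the window
    map.\<close>
  have "{seq_window (q ^ t - 1) (i j) (trace_seq emb t \<alpha>) | j. j < s} =
      (\<lambda>x. vec (q ^ t - 1) (\<lambda>k. field_trace emb t (\<alpha> ^ k * x))) ` ?S"
    by (auto simp: seq_window_def trace_seq_def power_add)
  then have S3: "S3 \<longleftrightarrow> E.V.independent ?S"
    unfolding S3_def q using E.lin_dep_trace_windows_iff[OF \<open>primitive_element \<alpha>\<close>, of ?S] by simp
  have S4: "S4 \<longleftrightarrow> E.V.independent ?S"
    unfolding S4_def E.minimal_poly_dvd_iff E.poly_map_sum_monom
    by (simp add: E.independent_image_iff[OF inj finite_lessThan] Bex_def)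
  have nz: "0 \<notin> ?S" using \<open>primitive_element \<alpha>\<close> by (auto simp: primitive_element_def)
  have "proj_point emb ` ?S \<subseteq> P \<longleftrightarrow> (\<forall>j<s. proj_point emb (\<alpha> ^ i j) \<in> P)" for P
    by auto
  then have S5: "S5 \<longleftrightarrow> E.V.independent ?S"
    unfolding S5_def E.independent_iff_no_flat[OF nz card \<open>1 \<le> s\<close> \<open>s \<le> t\<close>]
    by simp
  have S6: "S6 \<longleftrightarrow> E.V.independent ?S" if "s = t"
    unfolding S6_def E.zero_row_trace_array_iff[OF \<open>primitive_element \<alpha>\<close>]
    using E.independent_iff_traces_inj[of ?S] card that by blast
  show ?thesis using S1 S2 S3 S4 S5 S6 by blast
qed

end
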